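(* Let $n\ge 2$, write $n-1=2^{\alpha}N$ with $\alpha\ge0$ and $N$ odd, and let $r=2^{\alpha+1}$. Let $Q_n(x)$ be the associated polynomial of the Dynkin diagram of type $D_n$. Then $$Q_n(x)=\Phi_4(x)\prod_{\substack{d\mid n-1\\ d\ \mathrm{odd}}}\Phi_{2rd}(x),$$ where $d$ runs over the positive odd divisors of $n-1$ and $\Phi_k$ denotes the $k$-th cyclotomic polynomial.
   Context: Let $C$ be the $n\times n$ Cartan matrix of type $D_n$: all diagonal entries are $2$, $c_{i,i+1}=c_{i+1,i}=-1$ for $1\le i\le n-2$, $c_{n-2,n}=c_{n,n-2}=-1$ if $n\ge3$, and all other entries are $0$ (so for $n=2$, $C=2I_2$). The Coxeter adjacency matrix is $A=2I_n-C$, and $a_n(x)=\det(xI_n-A)$ is its characteristic polynomial. The associated polynomial is $Q_n(x)=x^n a_n\left(x+\frac1x\right)$, a polynomial of degree $2n$. *)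

theory Defs
  imports Jordan_Normal_Form.Char_Poly
    "HOL-Computational_Algebra.Polynomial_Factorial"
begin

(* Entries of the Cartan matrix of type D_n, with row and column indices in {1..n}.
   For n = 2 the matrix is twice the identity. *)
definition cartan_D_entry :: "nat \<Rightarrow> nat \<Rightarrow> nat \<Rightarrow> int" where
  "cartan_D_entry n i j =
     (if i = j then 2
      else if 1 \<le> i \<and> i \<le> n - 2 \<and> j = i + 1 then -1
      else if 1 \<le> j \<and> j \<le> n - 2 \<and> i = j + 1 then -1
      else if n \<ge> 3 \<and> (i = n - 2 \<and> j = n \<or> i = n \<and> j = n - 2) then -1
      else 0)"

(* Matrices of Jordan_Normal_Form are indexed from 0. *)
definition cartan_D :: "nat \<Rightarrow> int mat" where
  "cartan_D n = mat n n (\<lambda>(i, j). cartan_D_entry n (i + 1) (j + 1))"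

definition coxeter_adj_D :: "nat \<Rightarrow> int mat" where
  "coxeter_adj_D n = 2 \<cdot>\<^sub>m 1\<^sub>m n - cartan_D n"

abbreviation coxeter_poly_D :: "nat \<Rightarrow> int poly" where
  "coxeter_poly_D n \<equiv> char_poly (coxeter_adj_D n)"

abbreviation fract_X :: "int poly fract" where
  "fract_X \<equiv> to_fract [:0, 1:]"

(* The polynomial q with q(x) = x^n a_n(x + 1/x); the equation is read in the field of
   rational functions.  Existence and uniqueness of q: associated_poly_D_iff below. *)
definition associated_poly_D :: "nat \<Rightarrow> int poly" where
  "associated_poly_D n = (THE q. to_fract q =
     fract_X ^ n * poly (map_poly of_int (coxeter_poly_D n)) (fract_X + 1 / fract_X))"

definition cyclotomic :: "nat \<Rightarrow> complex poly" where
  "cyclotomic k =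
     (\<Prod>z | z ^ k = 1 \<and> (\<forall>j. 0 < j \<and> j < k \<longrightarrow> z ^ j \<noteq> 1). [:- z, 1:])"

lemma to_fract_power: "to_fract (p ^ i) = to_fract p ^ i"
  by (induction i) simp_all

lemma to_fract_sum: "to_fract (sum f A) = (\<Sum>i\<in>A. to_fract (f i))"
  by (induction A rule: infinite_finite_induct) simp_all

lemma to_fract_of_nat: "to_fract (of_nat m) = of_nat m"
  by (induction m) simp_all

lemma to_fract_of_int: "to_fract (of_int c) = of_int c"
  by (cases c rule: int_cases2) (simp_all add: to_fract_of_nat)

lemma associated_poly_D_exists:
  "\<exists>q. to_fract q =
     fract_X ^ n * poly (map_poly of_int (coxeter_poly_D n)) (fract_X + 1 / fract_X)"
proof -
  let ?a = "coxeter_poly_D n"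
  let ?q = "\<Sum>i\<le>n. of_int (coeff ?a i) * [:0, 1:] ^ (n - i) * ([:0, 1:] ^ 2 + 1) ^ i"
  have carrier: "coxeter_adj_D n \<in> carrier_mat n n"
    unfolding coxeter_adj_D_def cartan_D_def by (intro carrier_matI) simp_all
  have deg: "degree ?a = n"
    using degree_monic_char_poly[OF carrier] by simp
  have deg': "degree (map_poly of_int ?a :: int poly fract poly) = n"
    using degree_monic_char_poly[OF carrier] by (subst degree_map_poly) auto
  have X: "fract_X \<noteq> 0" by simp
  have pow: "fract_X ^ (n - i) * (fract_X ^ 2 + 1) ^ i
      = fract_X ^ n * (fract_X + 1 / fract_X) ^ i" if "i \<le> n" for i
  proof -
    have "fract_X * (fract_X + 1 / fract_X) = fract_X ^ 2 + 1"
      using X by (simp add: field_simps power2_eq_square)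
    then have "(fract_X ^ 2 + 1) ^ i = fract_X ^ i * (fract_X + 1 / fract_X) ^ i"
      by (metis power_mult_distrib)
    moreover have "fract_X ^ n = fract_X ^ (n - i) * fract_X ^ i"
      using that by (metis le_add_diff_inverse2 power_add)
    ultimately show ?thesis by (simp add: mult.assoc)
  qed
  have "to_fract ?q = (\<Sum>i\<le>n. of_int (coeff ?a i) *
      (fract_X ^ (n - i) * (fract_X ^ 2 + 1) ^ i))"
    by (simp add: to_fract_sum to_fract_power to_fract_of_int mult.assoc)
  also have "\<dots> = (\<Sum>i\<le>n. of_int (coeff ?a i) *
      (fract_X ^ n * (fract_X + 1 / fract_X) ^ i))"
    by (intro sum.cong refl) (simp only: pow atMost_iff)
  also have "\<dots> = fract_X ^ n * poly (map_poly of_int ?a) (fract_X + 1 / fract_X)"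
    unfolding poly_altdef deg' sum_distrib_left
    by (intro sum.cong refl) (simp add: coeff_map_poly mult_ac)
  finally show ?thesis by blast
qed

lemma associated_poly_D_iff:
  "q = associated_poly_D n \<longleftrightarrow> to_fract q =
     fract_X ^ n * poly (map_poly of_int (coxeter_poly_D n)) (fract_X + 1 / fract_X)"
proof -
  have "\<exists>!q. to_fract q =
     fract_X ^ n * poly (map_poly of_int (coxeter_poly_D n)) (fract_X + 1 / fract_X)"
    using associated_poly_D_exists by (metis to_fract_eq_iff)
  from theI'[OF this] show ?thesis
    unfolding associated_poly_D_def by (metis to_fract_eq_iff)
qed

end

theory Submission
  imports Defs "HOL-Computational_Algebra.Fundamental_Theorem_Algebra"
begin

text \<open>
  Expanding along the end vertex of the long arm gives
  \<open>a\<^sub>n = x a\<^sub>n\<^sub>-\<^sub>1 - a\<^sub>n\<^sub>-\<^sub>2\<close> for \<open>n \<ge> 4\<close>, whence \<open>Q\<^sub>n = (x ^ 2 + 1) * (x ^ (2 * (n - 1)) + 1)\<close> by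
  induction. For odd \<open>N\<close>, the roots of \<open>x ^ (2 ^ s * N) + 1\<close> are exactly the complex numbers of
  multiplicative order \<open>2 ^ (s + 1) * d\<close> with \<open>d\<close> dividing \<open>N\<close>, so this polynomial is the product
  of the corresponding cyclotomic polynomials. Both factors of \<open>Q\<^sub>n\<close> are of this form, with
  \<open>s = 1\<close>, \<open>N = 1\<close> for \<open>x\<^sup>2 + 1\<close>.
\<close>

section \<open>Determinant expansions\<close>

text \<open>Expand along row 0; in the minor at \<open>(0, 1)\<close>, column 0 retains only its top
  entry, so expand down it. The rest of \<open>M\<close> is arbitrary, which leaves room for the
  fork of the diagram.\<close>

lemma det_tridiagonal_start:
  fixes M :: "'a :: comm_ring_1 mat"
  assumes M: "M \<in> carrier_mat (n + 2) (n + 2)"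
    and row: "\<And>j. 2 \<le> j \<Longrightarrow> j < n + 2 \<Longrightarrow> M $$ (0, j) = 0"
    and col: "\<And>i. 2 \<le> i \<Longrightarrow> i < n + 2 \<Longrightarrow> M $$ (i, 0) = 0"
  shows "det M = M $$ (0, 0) * det (mat_delete M 0 0)
    - M $$ (0, 1) * M $$ (1, 0) * det (mat_delete (mat_delete M 0 0) 0 0)"
proof -
  let ?B = "mat_delete M 0 1"
  have B: "?B \<in> carrier_mat (n + 1) (n + 1)"
    using mat_delete_carrier[OF M, of 0 1] by simp
  have entry: "?B $$ (i, 0) = M $$ (Suc i, 0)" if "i < n + 1" for i
    using that M by (simp add: mat_delete_def)
  have "det ?B = (\<Sum>i<n + 1. ?B $$ (i, 0) * cofactor ?B i 0)"
    by (rule laplace_expansion_column[OF B]) simp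
  also have "\<dots> = (\<Sum>i\<in>{0}. ?B $$ (i, 0) * cofactor ?B i 0)"
    by (rule sum.mono_neutral_right) (use entry col in auto)
  also have "\<dots> = M $$ (1, 0) * det (mat_delete ?B 0 0)"
    using entry[of 0] by (simp add: cofactor_def)
  also have "mat_delete ?B 0 0 = mat_delete (mat_delete M 0 0) 0 0"
    using M by (intro eq_matI) (auto simp: mat_delete_def)
  finally have detB: "det ?B = M $$ (1, 0) * det (mat_delete (mat_delete M 0 0) 0 0)" .
  have "det M = (\<Sum>j<n + 2. M $$ (0, j) * cofactor M 0 j)"
    by (rule laplace_expansion_row[OF M]) simp
  also have "\<dots> = (\<Sum>j\<in>{0, 1}. M $$ (0, j) * cofactor M 0 j)"
    by (rule sum.mono_neutral_right) (auto simp: row)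
  also have "\<dots> = M $$ (0, 0) * det (mat_delete M 0 0) - M $$ (0, 1) * det ?B"
    by (simp add: cofactor_def)
  finally show ?thesis
    unfolding detB by (simp add: mult.assoc)
qed

lemma det_2_by_2:
  fixes M :: "'a :: comm_ring_1 mat"
  assumes M: "M \<in> carrier_mat 2 2"
  shows "det M = M $$ (0, 0) * M $$ (1, 1) - M $$ (0, 1) * M $$ (1, 0)"
proof -
  have 1: "mat_delete M 0 0 \<in> carrier_mat 1 1"
    using mat_delete_carrier[OF M, of 0 0] by simp
  have 0: "mat_delete (mat_delete M 0 0) 0 0 \<in> carrier_mat 0 0"
    using mat_delete_carrier[OF 1, of 0 0] by simp
  \<comment> \<open>For \<open>n = 0\<close> the vanishing conditions on row and column 0 are
    vacuous.\<close>
  have "M \<in> carrier_mat (0 + 2) (0 + 2)"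
    using M by (simp add: numeral_2_eq_2)
  from det_tridiagonal_start[OF this] det_single[OF 1] det_dim_zero[OF 0] M show ?thesis
    by (simp add: mat_delete_def)
qed

text \<open>Serves type D_3, where vertex 1 is joined to both 2 and 3, so that
  \<open>det_tridiagonal_start\<close> does not apply.\<close>

lemma det_3_by_3:
  fixes M :: "'a :: comm_ring_1 mat"
  assumes M: "M \<in> carrier_mat 3 3"
  shows "det M =
    M $$ (0, 0) * (M $$ (1, 1) * M $$ (2, 2) - M $$ (1, 2) * M $$ (2, 1))
    - M $$ (0, 1) * (M $$ (1, 0) * M $$ (2, 2) - M $$ (1, 2) * M $$ (2, 0))
    + M $$ (0, 2) * (M $$ (1, 0) * M $$ (2, 1) - M $$ (1, 1) * M $$ (2, 0))"
proof -
  have minor: "mat_delete M 0 j \<in> carrier_mat 2 2" for j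
    using mat_delete_carrier[OF M, of 0 j] by simp
  have "det M = (\<Sum>j<3. M $$ (0, j) * cofactor M 0 j)"
    by (rule laplace_expansion_row[OF M]) simp
  also have "{..<3} = {0, 1, 2::nat}"
    by auto
  finally show ?thesis
    using M unfolding cofactor_def det_2_by_2[OF minor]
    by (simp add: mat_delete_def algebra_simps flip: numeral_2_eq_2)
qed

section \<open>The characteristic polynomial of type D_n and its recurrence\<close>

text \<open>This is xI - A. As A = 2I - C has zero diagonal, the entries of C reappear unchanged off
  the diagonal.\<close>

definition char_matrix_D :: "nat \<Rightarrow> int poly mat" where
  "char_matrix_D n =
    mat n n (\<lambda>(i, j). if i = j then [:0, 1:] else [:cartan_D_entry n (i + 1) (j + 1):])"

lemma coxeter_poly_D_eq_det: "coxeter_poly_D n = det (char_matrix_D n)"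
proof -
  have "char_poly_matrix (coxeter_adj_D n) = char_matrix_D n"
    by (rule eq_matI)
      (auto simp: char_poly_matrix_def char_matrix_D_def coxeter_adj_D_def cartan_D_def
        cartan_D_entry_def)
  then show ?thesis
    by (simp add: char_poly_def)
qed

text \<open>Deleting vertex 1 and renumbering carries the diagram of type D_{n+1} to that of D_n.
  This includes \<open>n = 2\<close>, where removing the middle of a path leaves two isolated
  vertices.\<close>

lemma mat_delete_char_matrix_D:
  assumes "n \<ge> 2"
  shows "mat_delete (char_matrix_D (Suc n)) 0 0 = char_matrix_D n"
  using assms
  by (intro eq_matI) (auto simp: mat_delete_def char_matrix_D_def cartan_D_entry_def)

lemma coxeter_poly_D_2: "coxeter_poly_D 2 = [:0, 1:] ^ 2"
proof -
  have "char_matrix_D 2 \<in> carrier_mat 2 2"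
    by (simp add: char_matrix_D_def)
  from det_2_by_2[OF this] show ?thesis
    by (simp add: coxeter_poly_D_eq_det char_matrix_D_def cartan_D_entry_def power2_eq_square)
qed

lemma coxeter_poly_D_3: "coxeter_poly_D 3 = [:0, 1:] ^ 3 - 2 * [:0, 1:]"
proof -
  have "char_matrix_D 3 \<in> carrier_mat 3 3"
    by (simp add: char_matrix_D_def)
  from det_3_by_3[OF this] show ?thesis
    by (simp add: coxeter_poly_D_eq_det char_matrix_D_def cartan_D_entry_def power3_eq_cube
        numeral_poly)
qed

text \<open>From size 4 on, vertex 1 is a leaf attached to vertex 2, so the tridiagonal expansion
  applies.\<close>

lemma coxeter_poly_D_rec:
  assumes "n \<ge> 2"
  shows "coxeter_poly_D (n + 2) = [:0, 1:] * coxeter_poly_D (n + 1) - coxeter_poly_D n"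
proof -
  have M: "char_matrix_D (n + 2) \<in> carrier_mat (n + 2) (n + 2)"
    by (simp add: char_matrix_D_def)
  have "char_matrix_D (n + 2) $$ (0, 0) = [:0, 1:]"
    "char_matrix_D (n + 2) $$ (0, 1) = -1" "char_matrix_D (n + 2) $$ (1, 0) = -1"
    using assms by (simp_all add: char_matrix_D_def cartan_D_entry_def one_pCons)
  moreover have "det (char_matrix_D (n + 2)) =
      char_matrix_D (n + 2) $$ (0, 0) * det (mat_delete (char_matrix_D (n + 2)) 0 0)
      - char_matrix_D (n + 2) $$ (0, 1) * char_matrix_D (n + 2) $$ (1, 0)
        * det (mat_delete (mat_delete (char_matrix_D (n + 2)) 0 0) 0 0)"
    by (rule det_tridiagonal_start[OF M])
      (use assms in \<open>auto simp: char_matrix_D_def cartan_D_entry_def\<close>)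
  ultimately show ?thesis
    using assms by (simp add: coxeter_poly_D_eq_det mat_delete_char_matrix_D)
qed

text \<open>Stated over a general field so that \<open>t\<close> can be the indeterminate
  \<open>fract_X\<close>.\<close>

lemma coxeter_poly_D_at_reciprocal_sum:
  fixes t :: "'a :: field_char_0"
  assumes "n \<ge> 2" and t: "t \<noteq> 0"
  shows "t ^ n * poly (map_poly of_int (coxeter_poly_D n)) (t + 1 / t)
    = (t ^ 2 + 1) * (t ^ (2 * (n - 1)) + 1)"
  using assms(1)
proof (induction n rule: less_induct)
  case (less n)
  let ?p = "\<lambda>n. poly (map_poly of_int (coxeter_poly_D n)) (t + 1 / t)"
  consider "n = 2" | "n = 3" | m where "n = m + 2" "m \<ge> 2"
    using less.prems by (cases "n \<ge> 4") (force simp: le_iff_add, force)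
  then show ?case
  proof cases
    case 1
    then show ?thesis
      using t
      by (simp add: coxeter_poly_D_2 of_int_poly_hom.hom_power power2_eq_square field_simps)
  next
    case 2
    have p3: "?p 3 = (t + 1 / t) ^ 3 - 2 * (t + 1 / t)"
      by (simp add: coxeter_poly_D_3 of_int_poly_hom.hom_power of_int_poly_hom.hom_minus
          of_int_poly_hom.hom_mult of_int_poly_hom.hom_numeral)
    show ?thesis
      unfolding 2 p3 using t by (simp add: field_simps eval_nat_numeral)
  next
    case 3
    \<comment> \<open>Writing \<open>m = Suc k\<close> removes the truncated subtraction from the
      exponents.\<close>
    obtain k where m: "m = Suc k"
      using 3(2) by (cases m) auto
    have IH: "t ^ m * ?p m = (t ^ 2 + 1) * (t ^ (2 * k) + 1)"
      "t ^ (m + 1) * ?p (m + 1) = (t ^ 2 + 1) * (t ^ (2 * k + 2) + 1)"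
      using less.IH[of m] less.IH[of "m + 1"] 3 by (simp_all add: m)
    have p_rec: "?p n = (t + 1 / t) * ?p (m + 1) - ?p m"
      unfolding 3(1) coxeter_poly_D_rec[OF 3(2)]
      by (simp only: of_int_poly_hom.hom_minus of_int_poly_hom.hom_mult poly_diff poly_mult) simp
    have "t ^ n * ?p n
        = (t * (t + 1 / t)) * (t ^ (m + 1) * ?p (m + 1)) - t ^ 2 * (t ^ m * ?p m)"
      unfolding p_rec by (simp add: 3(1) algebra_simps power2_eq_square)
    also have "t * (t + 1 / t) = t ^ 2 + 1"
      using t by (simp add: field_simps power2_eq_square)
    \<comment> \<open>After cancelling t^2 + 1, this is (t^2 + 1)(t^(2k+2) + 1) - t^2 (t^(2k) + 1) =
      t^(2k+4) + 1.\<close>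
    finally show ?thesis
      unfolding IH by (simp add: 3(1) m algebra_simps power_add eval_nat_numeral)
  qed
qed

lemma associated_poly_D_eq:
  assumes "n \<ge> 2"
  shows "associated_poly_D n = ([:0, 1:] ^ 2 + 1) * ([:0, 1:] ^ (2 * (n - 1)) + 1)"
proof -
  have "to_fract (([:0, 1:] ^ 2 + 1) * ([:0, 1:] ^ (2 * (n - 1)) + 1)) =
      fract_X ^ n * poly (map_poly of_int (coxeter_poly_D n)) (fract_X + 1 / fract_X)"
    using coxeter_poly_D_at_reciprocal_sum[OF assms, of fract_X]
    by (simp add: to_fract_power)
  then show ?thesis
    by (metis associated_poly_D_iff)
qed

section \<open>Roots of unity and products of cyclotomic polynomials\<close>

text \<open>The index set of the product in \<open>cyclotomic\<close>. At \<open>k = 0\<close> it is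
  the whole complex plane, hence the positivity conditions below.\<close>

abbreviation primitive_roots :: "nat \<Rightarrow> complex set" where
  "primitive_roots k \<equiv> {z. z ^ k = 1 \<and> (\<forall>j. 0 < j \<and> j < k \<longrightarrow> z ^ j \<noteq> 1)}"

lemma primitive_roots_power_eq_1_iff:
  assumes "z \<in> primitive_roots k" "k > 0"
  shows "z ^ a = 1 \<longleftrightarrow> k dvd a"
proof -
  have "z ^ a = (z ^ k) ^ (a div k) * z ^ (a mod k)"
    by (simp flip: power_mult power_add)
  then have "z ^ a = z ^ (a mod k)"
    using assms by simp
  moreover have "z ^ (a mod k) = 1 \<longleftrightarrow> a mod k = 0"
    using assms by (auto simp: dest: spec[of _ "a mod k"])
  ultimately show ?thesis
    by (simp add: dvd_eq_mod_eq_0)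
qed

lemma primitive_roots_exists:
  assumes "(z :: complex) ^ m = 1" "m > 0"
  obtains k where "k > 0" "z \<in> primitive_roots k"
proof -
  define k where "k = (LEAST k. k > 0 \<and> z ^ k = 1)"
  have "k > 0 \<and> z ^ k = 1"
    unfolding k_def by (rule LeastI[of _ m]) (use assms in simp)
  moreover have "z ^ j \<noteq> 1" if "0 < j" "j < k" for j
    using not_less_Least[of j "\<lambda>k. k > 0 \<and> z ^ k = 1"] that by (auto simp: k_def)
  ultimately show ?thesis
    using that by blast
qed

text \<open>A number is a root exactly when its order divides 2^(s+1) N but not 2^s N; as N is odd,
  the order then carries the full power 2^(s+1).\<close>

lemma roots_of_minus_1_eq_Union_primitive_roots:
  assumes "odd N"
  shows "{z :: complex. z ^ (2 ^ s * N) = -1} =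
    (\<Union>d\<in>{d. d dvd N}. primitive_roots (2 ^ (s + 1) * d))"
proof (intro equalityI subsetI)
  have N: "N > 0"
    using assms by (rule odd_pos)
  fix z :: complex
  assume "z \<in> {z. z ^ (2 ^ s * N) = -1}"
  then have z: "z ^ (2 ^ s * N) = -1"
    by simp
  have "z ^ (2 ^ s * N * 2) = 1"
    by (subst power_mult) (simp add: z)
  then have z2: "z ^ (2 ^ (s + 1) * N) = 1"
    by (simp add: mult_ac)
  obtain k where k: "k > 0" "z \<in> primitive_roots k"
    by (rule primitive_roots_exists[OF z2]) (use N in simp)
  from z2 have "k dvd 2 ^ (s + 1) * N"
    using primitive_roots_power_eq_1_iff[OF k(2,1)] by blast
  then obtain c where c: "2 ^ (s + 1) * N = k * c" ..
  have "\<not> k dvd 2 ^ s * N"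
    using primitive_roots_power_eq_1_iff[OF k(2,1), of "2 ^ s * N"] z by simp
  \<comment> \<open>For even \<open>c\<close>, halving the equation would give
    \<open>k dvd 2 ^ s * N\<close>.\<close>
  then have "odd c"
    using c by (auto elim!: evenE)
  then have "2 ^ (s + 1) dvd k"
    using c
    by (metis coprime_dvd_mult_left_iff coprime_left_2_iff_odd coprime_power_left_iff
        dvd_triv_left)
  then obtain d where d: "k = 2 ^ (s + 1) * d" ..
  have "d dvd N"
    using c by (simp add: d mult.assoc)
  then show "z \<in> (\<Union>d\<in>{d. d dvd N}. primitive_roots (2 ^ (s + 1) * d))"
    using k d by blast
next
  fix z :: complex
  assume "z \<in> (\<Union>d\<in>{d. d dvd N}. primitive_roots (2 ^ (s + 1) * d))"
  then obtain d where d: "d dvd N" and z: "z \<in> primitive_roots (2 ^ (s + 1) * d)"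
    by blast
  have "d > 0"
    using d assms by (cases d) auto
  then have eq1: "z ^ a = 1 \<longleftrightarrow> 2 ^ (s + 1) * d dvd a" for a
    using primitive_roots_power_eq_1_iff[OF z] by simp
  have "\<not> 2 * d dvd N"
    using assms by auto
  then have "\<not> 2 ^ (s + 1) * d dvd 2 ^ s * N"
    by (simp add: mult_ac)
  then have "z ^ (2 ^ s * N) \<noteq> 1"
    by (simp only: eq1 not_False_eq_True)
  moreover have "z ^ (2 ^ (s + 1) * N) = 1"
    using d by (simp only: eq1 mult_dvd_mono dvd_refl)
  then have "(z ^ (2 ^ s * N)) ^ 2 = 1"
    by (simp add: mult_ac flip: power_mult)
  \<comment> \<open>A square root of 1 other than 1 is -1.\<close>
  ultimately show "z \<in> {z. z ^ (2 ^ s * N) = -1}"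
    by (simp add: power2_eq_1_iff)
qed

text \<open>The right-hand side is monic with simple roots, hence the product of its linear factors;
  grouping the roots by order gives the cyclotomic factors.\<close>

lemma prod_cyclotomic_eq:
  assumes "odd N"
  shows "(\<Prod>d | d dvd N. cyclotomic (2 ^ (s + 1) * d)) = [:0, 1:] ^ (2 ^ s * N) + 1"
proof -
  let ?m = "2 ^ s * N"
  let ?p = "monom 1 ?m + 1 :: complex poly"
  have N: "N > 0"
    using assms by (rule odd_pos)
  have fin: "finite (primitive_roots (2 ^ (s + 1) * d))" if "d dvd N" for d
  proof -
    have "2 ^ (s + 1) * d > 0"
      using that N by (cases d) auto
    then have "finite {z :: complex. z ^ (2 ^ (s + 1) * d) = 1}"
      by (intro finite_roots_unity) simp
    then show ?thesis
      by (rule rev_finite_subset) auto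
  qed
  \<comment> \<open>The order of \<open>z\<close> is unique: two candidates divide each
    other.\<close>
  have disj: "d = e" if "d dvd N" "e dvd N" "z \<in> primitive_roots (2 ^ (s + 1) * d)"
    "z \<in> primitive_roots (2 ^ (s + 1) * e)" for d e z
  proof -
    have "d > 0" "e > 0"
      using that(1,2) N by (auto intro: dvd_pos_nat)
    then have "z ^ a = 1 \<longleftrightarrow> 2 ^ (s + 1) * d dvd a"
      "z ^ a = 1 \<longleftrightarrow> 2 ^ (s + 1) * e dvd a" for a
      using that(3,4) by (intro primitive_roots_power_eq_1_iff; simp)+
    then have "2 ^ (s + 1) * d = 2 ^ (s + 1) * e"
      by (metis dvd_antisym dvd_refl)
    then show ?thesis
      by simp
  qed
  have deg: "degree ?p = ?m"
    using N by (simp add: degree_add_eq_left degree_monom_eq)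
  have lc: "lead_coeff ?p = 1"
    using N by (simp add: deg)
  \<comment> \<open>A root of the derivative can only be 0, where \<open>?p\<close> takes the value
    1.\<close>
  have "rsquarefree ?p"
    using N by (auto simp: rsquarefree_roots pderiv_add pderiv_monom poly_monom power_0_left)
  from complex_poly_decompose_rsquarefree[OF this]
  have "?p = (\<Prod>z | poly ?p z = 0. [:- z, 1:])"
    unfolding lc by simp
  also have "{z. poly ?p z = 0} = {z. z ^ ?m = -1}"
    by (auto simp: poly_monom add_eq_0_iff2)
  also have "\<dots> = (\<Union>d\<in>{d. d dvd N}. primitive_roots (2 ^ (s + 1) * d))"
    by (rule roots_of_minus_1_eq_Union_primitive_roots[OF assms])
  also have "(\<Prod>z\<in>\<dots>. [:- z, 1:]) = (\<Prod>d | d dvd N. cyclotomic (2 ^ (s + 1) * d))"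
    unfolding cyclotomic_def
    by (rule prod.UNION_disjoint) (use N fin disj in auto)
  finally show ?thesis
    by (simp add: x_pow_n monom_altdef)
qed

theorem proposition10:
  fixes n \<alpha> N r :: nat
  assumes "n \<ge> 2"
    and "n - 1 = 2 ^ \<alpha> * N"
    and "odd N"
    and "r = 2 ^ (\<alpha> + 1)"
  shows "map_poly complex_of_int (associated_poly_D n) =
    cyclotomic 4 * (\<Prod>d | d dvd n - 1 \<and> odd d. cyclotomic (2 * r * d))"
proof -
  have "{d. d dvd n - 1 \<and> odd d} = {d. d dvd N}"
    unfolding assms(2) using assms(3)
    by (auto simp: coprime_dvd_mult_right_iff)
  \<comment> \<open>Here s = \<alpha> + 1, since 2r = 2^(\<alpha>+2) and 2(n - 1) = 2^(\<alpha>+1)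
    N.\<close>
  then have "(\<Prod>d | d dvd n - 1 \<and> odd d. cyclotomic (2 * r * d))
      = [:0, 1:] ^ (2 * (n - 1)) + 1"
    using prod_cyclotomic_eq[OF assms(3), of "\<alpha> + 1"]
    unfolding assms(2,4) by (simp add: mult.assoc)
  moreover have "cyclotomic 4 = [:0, 1:] ^ 2 + 1"
    using prod_cyclotomic_eq[of 1 1] by simp
  moreover have "map_poly complex_of_int (associated_poly_D n)
      = ([:0, 1:] ^ 2 + 1) * ([:0, 1:] ^ (2 * (n - 1)) + 1)"
    unfolding associated_poly_D_eq[OF assms(1)]
    by (simp add: of_int_poly_hom.hom_mult of_int_poly_hom.hom_add of_int_poly_hom.hom_power)
  ultimately show ?thesis
    by simp
qed

end
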